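(* Let $p\geq 1$, $A>0$, and let $0<a_1\leq\dots\leq a_p$ and $0<b_1\leq\dots\leq b_p$ satisfy $\sum_{j=1}^kb_j-\sum_{j=1}^ka_j\geq 0$ for $k=1,\dots,p$. Suppose that $$\prod_{i=1}^{p}\left[\frac{\Gamma(a_i+A)}{\Gamma(b_i+A)}-\frac{\Gamma(a_i+2A)}{\Gamma(b_i+2A)}(1-e)\right]\leq\prod_{i=1}^{p}\frac{\Gamma(a_i)}{\Gamma(b_i)}.$$ Then the function $${}_p\tilde{\Psi}_{p}\left[{(a_1,A),\dots,(a_p,A)\atop (b_1,A),\dots,(b_p,A)}\Big|z\right]$$ is starlike in $\mathcal{D}_{1/2}=\{z\in\mathbb{C}:|z|<1/2\}$.
   Context: The normalized Fox-Wright function is $${}_p\tilde{\Psi}_q\left[{(a_1,A_1),\dots,(a_p,A_p)\atop (b_1,B_1),\dots,(b_q,B_q)}\Big|z\right]=\frac{\prod_{j=1}^q\Gamma(b_j)}{\prod_{i=1}^p\Gamma(a_i)}\sum_{k=0}^\infty\frac{\prod_{i=1}^p\Gamma(a_i+kA_i)}{\prod_{j=1}^q\Gamma(b_j+kB_j)}\frac{z^{k+1}}{k!}.$$ A function $f(z)=z+\sum_{k\ge2}a_kz^k$ analytic in the unit disc is starlike in $\mathcal{D}_{1/2}$ if it is univalent in $\mathcal{D}_{1/2}$ and $f(\mathcal{D}_{1/2})$ is starlike with respect to the origin; equivalently $\Re\left(zf'(z)/f(z)\right)>0$ for $|z|<1/2$. Here $e=\exp(1)$. *)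

theory Defs
  imports "HOL-Complex_Analysis.Complex_Analysis"
begin

text \<open>
  The upper parameters are \<open>(a i, A i)\<close> for \<open>i = 1..p\<close> and the lower parameters are
  \<open>(b j, B j)\<close> for \<open>j = 1..q\<close>; values of these functions at other indices are irrelevant.
\<close>

definition normalized_fox_wright ::
    "nat \<Rightarrow> nat \<Rightarrow> (nat \<Rightarrow> complex) \<Rightarrow> (nat \<Rightarrow> real) \<Rightarrow> (nat \<Rightarrow> complex) \<Rightarrow> (nat \<Rightarrow> real) \<Rightarrow> complex \<Rightarrow> complex"
  where
  "normalized_fox_wright p q a A b B z =
     (\<Prod>j=1..q. Gamma (b j)) / (\<Prod>i=1..p. Gamma (a i)) *
     (\<Sum>k. (\<Prod>i=1..p. Gamma (a i + of_nat k * of_real (A i))) /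
           (\<Prod>j=1..q. Gamma (b j + of_nat k * of_real (B j))) * (z ^ (k + 1) / fact k))"

text \<open>The library's \<^const>\<open>starlike\<close> leaves the centre existentially quantified; here it is fixed.\<close>

definition starlike_wrt :: "'a::real_vector \<Rightarrow> 'a set \<Rightarrow> bool" where
  "starlike_wrt c S \<longleftrightarrow> c \<in> S \<and> (\<forall>x\<in>S. closed_segment c x \<subseteq> S)"

text \<open>
  The first three conjuncts say that \<open>f\<close> is analytic in the unit disc with a Taylor expansion
  \<open>f(z) = z + (terms of order \<ge> 2)\<close>.
\<close>

definition starlike_in_disc :: "real \<Rightarrow> (complex \<Rightarrow> complex) \<Rightarrow> bool" where
  "starlike_in_disc r f \<longleftrightarrow>
     f holomorphic_on ball 0 1 \<and> f 0 = 0 \<and> deriv f 0 = 1 \<and>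
     inj_on f (ball 0 r) \<and> starlike_wrt 0 (f ` ball 0 r)"

end

theory Submission
  imports Defs
begin

text \<open>
  Put \<open>R(x) = \<Prod>\<^sub>i \<Gamma>(a\<^sub>i + x) / \<Gamma>(b\<^sub>i + x)\<close>. As the digamma function is increasing and concave, the
  partial sum conditions make \<open>R\<close> decreasing, so the coefficients \<open>R(kA) / k!\<close> with \<open>k \<ge> 1\<close> sum to at
  most \<open>R(A) + (e - 2) R(2A)\<close>. The product in the hypothesis dominates
  \<open>R(A) + (e - 1)\<^sup>p R(2A)\<close>, hence this sum is at most \<open>R(0)\<close>.

  It remains to treat \<open>f(z) = \<Sum>\<^sub>k c\<^sub>k z\<^sup>k\<^sup>+\<^sup>1 = z Q(z)\<close> with \<open>c\<^sub>0 = 1\<close> and \<open>\<Sum>\<^sub>k\<^sub>\<ge>\<^sub>1 |c\<^sub>k| \<le> 1\<close>. Since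
  \<open>(k + 1) |z|\<^sup>k \<le> 2 |z|\<close> for \<open>|z| < 1/2\<close> and \<open>k \<ge> 1\<close>, we get \<open>|z Q'(z)| + |Q(z) - 1| \<le> 2 |z| < 1\<close>. This yields
  both \<open>|f' - 1| < 1\<close>, so \<open>f\<close> is univalent, and \<open>|z f' / f - 1| = |z Q' / Q| < 1\<close>, so \<open>f\<close> is starlike.
\<close>

section \<open>A derivative criterion for starlike images\<close>

text \<open>The derivative of \<open>s \<mapsto> |g(s w)|^2\<close> at \<open>t\<close> is twice the
  real part in \<open>pos\<close>. It is applied with \<open>g\<close> the inverse of
  \<open>f\<close>, to follow preimages along a ray towards the origin.\<close>

lemma norm_along_segment_decreasing:
  fixes g :: "complex \<Rightarrow> complex" and w :: complex and t :: real
  assumes g: "(g has_field_derivative g') (at (of_real t * w))"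
    and pos: "0 < Re (cnj (g (of_real t * w)) * w * g')"
  shows "\<exists>d>0. \<forall>h>0. h < d \<longrightarrow> norm (g (of_real (t - h) * w)) < norm (g (of_real t * w))"
proof -
  define u where "u = (\<lambda>s::real. g (of_real s * w))"
  have line: "((\<lambda>s::real. of_real s * w) has_vector_derivative w) (at t)"
    by (auto intro!: derivative_eq_intros simp: scaleR_conv_of_real has_vector_derivative_def)
  have u': "(u has_vector_derivative w * g') (at t)"
    using field_vector_diff_chain_at[OF line g] by (simp add: o_def u_def)
  have "((\<lambda>s. u s \<bullet> u s) has_real_derivative 2 * (u t \<bullet> (w * g'))) (at t)"
    using has_derivative_inner[OF u'[unfolded has_vector_derivative_def] u'[unfolded has_vector_derivative_def]]
    unfolding has_field_derivative_def
    by (rule has_derivative_eq_rhs) (auto simp: inner_commute)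
  moreover have "0 < 2 * (u t \<bullet> (w * g'))"
    using pos by (simp add: u_def inner_complex_def algebra_simps)
  ultimately obtain d where "d > 0" "\<forall>h>0. h < d \<longrightarrow> u (t - h) \<bullet> u (t - h) < u t \<bullet> u t"
    using DERIV_pos_inc_left[of "\<lambda>s. u s \<bullet> u s"] by blast
  then show ?thesis
    by (auto simp: u_def norm_lt)
qed

text \<open>
  If \<open>t f(z)\<close> is not a value of \<open>f\<close>, let \<open>s\<close> be the least parameter in \<open>[t, 1]\<close> for which \<open>s f(z)\<close> has a
  preimage of norm at most \<open>|z|\<close>. Moving slightly below \<open>s\<close> decreases the norm of the preimage, which
  contradicts minimality.
\<close>

lemma starlike_wrt_image_ball:
  fixes f :: "complex \<Rightarrow> complex"
  assumes hol: "f holomorphic_on ball 0 r" and inj: "inj_on f (ball 0 r)"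
    and "f 0 = 0" and "r > 0"
    and pos: "\<And>z. z \<in> ball 0 r \<Longrightarrow> z \<noteq> 0 \<Longrightarrow> 0 < Re (z * deriv f z / f z)"
  shows "starlike_wrt 0 (f ` ball 0 r)"
proof -
  let ?B = "ball (0::complex) r"
  have cont: "continuous_on ?B f"
    using hol by (rule holomorphic_on_imp_continuous_on)
  obtain g where g: "g holomorphic_on f ` ?B"
      "\<And>z. z \<in> ?B \<Longrightarrow> deriv f z * deriv g (f z) = 1" "\<And>z. z \<in> ?B \<Longrightarrow> g (f z) = z"
    using holomorphic_has_inverse[OF hol open_ball inj] by metis
  have op: "open (f ` ?B)"
    by (rule open_mapping_thm3[OF hol open_ball inj])
  have "of_real t * f z \<in> f ` ?B" if z: "z \<in> ?B" and t: "0 \<le> t" "t \<le> 1" for z and t :: real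
  proof (rule ccontr)
    assume out: "of_real t * f z \<notin> f ` ?B"
    have sub: "cball 0 (norm z) \<subseteq> ?B" using z by auto
    \<comment> \<open>Preimages are sought in the closed disc, whose image is compact; hence
      \<open>K\<close> is compact and has a least element.\<close>
    define K where "K = {s\<in>{t..1}. of_real s * f z \<in> f ` cball 0 (norm z)}"
    have "compact (f ` cball 0 (norm z))"
      by (intro compact_continuous_image continuous_on_subset[OF cont sub]) auto
    then have "closed ({t..1} \<inter> (\<lambda>s::real. of_real s * f z) -` (f ` cball 0 (norm z)))"
      by (intro closed_Int closed_vimage continuous_intros compact_imp_closed) auto
    moreover have "K = {t..1} \<inter> (\<lambda>s::real. of_real s * f z) -` (f ` cball 0 (norm z))"
      by (auto simp: K_def)
    moreover have "bounded K"
      by (rule bounded_subset[of "{t..1}"]) (auto simp: K_def)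
    ultimately have "compact K"
      by (simp add: compact_eq_bounded_closed)
    moreover have "1 \<in> K" using t z by (auto simp: K_def)
    ultimately obtain s where s: "s \<in> K" and s_min: "\<And>s'. s' \<in> K \<Longrightarrow> s \<le> s'"
      using compact_attains_inf[of K] by blast
    obtain x where x: "norm x \<le> norm z" "f x = of_real s * f z"
      using s by (auto simp: K_def image_iff)
    have xB: "x \<in> ?B" using x sub by auto
    have "s \<noteq> t" using x xB out by (metis image_eqI)
    then have "t < s" using s by (auto simp: K_def)
    have "x \<noteq> 0"
    proof
      assume "x = 0"
      then have "f z = 0" using x \<open>f 0 = 0\<close> \<open>t < s\<close> t by auto
      then show False using out \<open>f 0 = 0\<close> \<open>r > 0\<close> by (auto simp: image_iff intro!: bexI[of _ 0])
    qed
    have g': "(g has_field_derivative deriv g (f x)) (at (of_real s * f z))"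
      using g(1) op xB x by (metis holomorphic_derivI image_eqI)
    \<comment> \<open>As \<open>f z = f x / s\<close> and \<open>g' = 1 / f'\<close>, the expression
      is \<open>|x|^2 / s\<close> times the reciprocal of \<open>x f'(x) / f(x)\<close>, and a
      reciprocal keeps the sign of the real part.\<close>
    have "0 < Re (cnj x * f z * deriv g (f x))"
    proof -
      have f': "deriv g (f x) = inverse (deriv f x)"
        using g(2)[OF xB] by (metis inverse_unique)
      have "0 < Re (inverse (x * deriv f x / f x))"
        unfolding inverse_complex.sel
        using pos[OF xB \<open>x \<noteq> 0\<close>] by (intro divide_pos_pos sum_power2_gt_zero_iff[THEN iffD2]) auto
      then have "0 < (norm x)\<^sup>2 / s * Re (inverse (x * deriv f x / f x))"
        using \<open>x \<noteq> 0\<close> \<open>t < s\<close> t by simp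
      also have "\<dots> = Re (of_real ((norm x)\<^sup>2 / s) * inverse (x * deriv f x / f x))"
        by (simp only: Re_complex_of_real Im_complex_of_real times_complex.sel)
      also have "of_real ((norm x)\<^sup>2 / s) * inverse (x * deriv f x / f x) = cnj x * f z * inverse (deriv f x)"
        using \<open>x \<noteq> 0\<close> \<open>t < s\<close> t
        by (simp add: x(2) complex_norm_square divide_simps del: of_real_power)
      finally show ?thesis by (simp only: f')
    qed
    then obtain d1 where d1: "d1 > 0"
        "\<And>h. 0 < h \<Longrightarrow> h < d1 \<Longrightarrow> norm (g (of_real (s - h) * f z)) < norm x"
      using norm_along_segment_decreasing[OF g'] g(3)[OF xB] x by metis
    have "open ((\<lambda>s::real. of_real s * f z) -` (f ` ?B))"
      by (intro open_vimage op continuous_intros)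
    moreover have "s \<in> (\<lambda>s::real. of_real s * f z) -` (f ` ?B)"
      using x xB by (metis image_eqI vimageI)
    ultimately obtain d2 where d2: "d2 > 0" "\<And>s'. \<bar>s' - s\<bar> < d2 \<Longrightarrow> of_real s' * f z \<in> f ` ?B"
      unfolding open_dist dist_real_def by (metis vimage_eq)
    \<comment> \<open>The three bounds serve in turn to shrink the preimage, to stay inside the open
      image, and to keep \<open>s - h\<close> above \<open>t\<close>.\<close>
    define h where "h = min (min d1 d2) (s - t) / 2"
    have h: "0 < h" "h < d1" "h < d2" "h < s - t"
      using d1 d2 \<open>t < s\<close> by (auto simp: h_def)
    then obtain y where y: "y \<in> ?B" "f y = of_real (s - h) * f z"
      using d2(2)[of "s - h"] by (auto simp: image_iff)
    then have "norm y < norm x" using d1(2)[OF h(1,2)] g(3)[OF y(1)] by simp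
    then have "s - h \<in> K"
      using y x h s by (auto simp: K_def image_iff intro!: bexI[of _ y])
    then show False using s_min[of "s - h"] h by simp
  qed
  then show ?thesis
    unfolding starlike_wrt_def closed_segment_def
    using \<open>f 0 = 0\<close> \<open>r > 0\<close> by (auto simp: image_iff scaleR_conv_of_real intro!: bexI[of _ 0])
qed

section \<open>Power series with small coefficients\<close>

text \<open>On the closed disc through the farther of two points, \<open>f z - z\<close> has a
  Lipschitz constant below 1, so the points cannot share a value. Using this smaller disc allows the
  borderline \<open>C * r = 1\<close>, which is the case needed later.\<close>

lemma inj_on_ball_if_deriv_near_1:
  fixes f f' :: "complex \<Rightarrow> complex"
  assumes f: "\<And>z. norm z < r \<Longrightarrow> (f has_field_derivative f' z) (at z)"
    and f': "\<And>z. norm z < r \<Longrightarrow> norm (f' z - 1) \<le> C * norm z"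
    and C: "0 \<le> C" "C * r \<le> 1"
  shows "inj_on f (ball 0 r)"
proof (rule inj_onI, rule ccontr)
  fix z w assume zw: "z \<in> ball 0 r" "w \<in> ball 0 r" and eq: "f z = f w" and "z \<noteq> w"
  define \<rho> where "\<rho> = max (norm z) (norm w)"
  have \<rho>: "\<rho> < r" "0 \<le> \<rho>" using zw by (auto simp: \<rho>_def le_max_iff_disj)
  have "norm ((f z - z) - (f w - w)) \<le> (C * \<rho>) * norm (z - w)"
  proof (rule field_differentiable_bound)
    fix x :: complex assume x: "x \<in> cball 0 \<rho>"
    then show "((\<lambda>z. f z - z) has_field_derivative f' x - 1) (at x within cball 0 \<rho>)"
      using \<rho> by (auto intro!: derivative_eq_intros has_field_derivative_at_within[OF f])
    have "C * norm x \<le> C * \<rho>" using x C by (intro mult_left_mono) auto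
    then show "norm (f' x - 1) \<le> C * \<rho>" using f'[of x] x \<rho> by simp
  qed (auto simp: \<rho>_def)
  moreover have "C * \<rho> < 1"
  proof (cases "C = 0")
    case False
    then have "C * \<rho> < C * r" using C \<rho> by simp
    then show ?thesis using C by simp
  qed simp
  ultimately show False
    using eq \<open>z \<noteq> w\<close> by (simp add: norm_minus_commute)
qed

lemma powser_estimate_half_disc:
  fixes c :: "nat \<Rightarrow> complex"
  assumes "c 0 = 1" and sm: "summable (\<lambda>k. norm (c (Suc k)))"
    and le: "(\<Sum>k. norm (c (Suc k))) \<le> 1" and z: "norm z < 1 / 2"
  shows "norm (z * (\<Sum>k. diffs c k * z ^ k)) + norm ((\<Sum>k. c k * z ^ k) - 1) \<le> 2 * norm z"
proof -
  define \<rho> where "\<rho> = norm z"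
  have \<rho>: "0 \<le> \<rho>" "\<rho> < 1 / 2" using z by (auto simp: \<rho>_def)
  define S where "S = (\<lambda>k. norm (c (Suc k)))"
  \<comment> \<open>The coefficient \<open>c (Suc k)\<close> enters the two norms with weights
    \<open>k + 1\<close> and \<open>1\<close>, hence \<open>k + 2\<close>; one factor
    \<open>\<rho>\<close> is set aside. Equality at \<open>k = 0\<close> fixes the constant
    2.\<close>
  have pow: "(of_nat k + 2) * \<rho> ^ k \<le> 2" for k
  proof -
    have "(of_nat k + 2 :: real) \<le> 2 * 2 ^ k"
      by (induction k) auto
    then have "(of_nat k + 2) * \<rho> ^ k \<le> 2 * 2 ^ k * (1 / 2) ^ k"
      using \<rho> by (intro mult_mono power_mono) auto
    then show ?thesis by (simp add: power_one_over)
  qed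
  have bound: "of_nat (Suc k) * \<rho> ^ Suc k * S k + \<rho> ^ Suc k * S k \<le> 2 * \<rho> * S k" for k
    using mult_right_mono[OF pow[of k], of "\<rho> * S k"] \<rho> by (simp add: S_def algebra_simps)
  have smS: "summable (\<lambda>k. 2 * \<rho> * S k)"
    unfolding S_def by (intro summable_mult sm)
  have nonneg: "0 \<le> of_nat (Suc k) * \<rho> ^ Suc k * S k" "0 \<le> \<rho> ^ Suc k * S k" for k
    using \<rho> by (auto simp: S_def)
  have smA: "summable (\<lambda>k. of_nat (Suc k) * \<rho> ^ Suc k * S k)"
  proof (rule summable_comparison_test'[OF smS, of 0])
    show "norm (of_nat (Suc k) * \<rho> ^ Suc k * S k) \<le> 2 * \<rho> * S k" for k
      unfolding real_norm_def abs_of_nonneg[OF nonneg(1)]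
      using bound[of k] nonneg(2)[of k] by linarith
  qed
  have smB: "summable (\<lambda>k. \<rho> ^ Suc k * S k)"
  proof (rule summable_comparison_test'[OF smS, of 0])
    show "norm (\<rho> ^ Suc k * S k) \<le> 2 * \<rho> * S k" for k
      unfolding real_norm_def abs_of_nonneg[OF nonneg(2)]
      using bound[of k] nonneg(1)[of k] by linarith
  qed
  have smB': "summable (\<lambda>k. norm (c (Suc k) * z ^ Suc k))"
    using smB by (simp add: norm_mult norm_power S_def \<rho>_def mult_ac)
  have smA': "summable (\<lambda>k. norm (of_nat (Suc k) * c (Suc k) * z ^ Suc k))"
    using smA by (simp add: norm_mult norm_power S_def \<rho>_def mult_ac del: of_nat_Suc)
  have tail: "(\<Sum>k. c (Suc k) * z ^ Suc k) = (\<Sum>k. c k * z ^ k) - 1"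
    using suminf_split_head[of "\<lambda>k. c k * z ^ k"] summable_norm_cancel[OF smB'] \<open>c 0 = 1\<close>
    by (simp add: summable_Suc_iff[of "\<lambda>k. c k * z ^ k"] del: power_Suc)
  have "z * (\<Sum>k. diffs c k * z ^ k) = (\<Sum>k. of_nat (Suc k) * c (Suc k) * z ^ Suc k)"
  \<comment> \<open>Summability of the derived series comes from that of its product with
    \<open>z\<close>, by division.\<close>
  proof (cases "z = 0")
    case False
    have "summable (\<lambda>k. diffs c k * z ^ k)"
      using summable_mult[OF summable_norm_cancel[OF smA'], of "inverse z"] False
      by (simp add: diffs_def mult_ac del: of_nat_Suc)
    then show ?thesis
      by (subst suminf_mult[symmetric]) (simp_all add: diffs_def mult_ac del: of_nat_Suc)
  qed simp
  then have "norm (z * (\<Sum>k. diffs c k * z ^ k)) \<le> (\<Sum>k. of_nat (Suc k) * \<rho> ^ Suc k * S k)"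
    using summable_norm[OF smA'] by (simp add: norm_mult norm_power S_def \<rho>_def mult_ac del: of_nat_Suc)
  moreover have "norm ((\<Sum>k. c k * z ^ k) - 1) \<le> (\<Sum>k. \<rho> ^ Suc k * S k)"
    using summable_norm[OF smB'] unfolding tail by (simp add: norm_mult norm_power S_def \<rho>_def mult_ac)
  ultimately have "norm (z * (\<Sum>k. diffs c k * z ^ k)) + norm ((\<Sum>k. c k * z ^ k) - 1)
      \<le> (\<Sum>k. of_nat (Suc k) * \<rho> ^ Suc k * S k + \<rho> ^ Suc k * S k)"
    by (simp add: suminf_add[OF smA smB, symmetric] del: of_nat_Suc power_Suc)
  also have "\<dots> \<le> (\<Sum>k. 2 * \<rho> * S k)"
    using sm by (intro suminf_le bound summable_add smA smB summable_mult) (simp add: S_def)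
  also have "\<dots> = 2 * \<rho> * (\<Sum>k. S k)"
    using sm by (simp add: suminf_mult S_def)
  also have "\<dots> \<le> 2 * \<rho> * 1"
    using le \<rho> by (intro mult_left_mono) (auto simp: S_def)
  finally show ?thesis by (simp add: \<rho>_def)
qed

theorem starlike_in_half_disc_powser:
  fixes c :: "nat \<Rightarrow> complex"
  assumes c0: "c 0 = 1" and sm: "summable (\<lambda>k. norm (c (Suc k)))"
    and le: "(\<Sum>k. norm (c (Suc k))) \<le> 1"
  shows "starlike_in_disc (1 / 2) (\<lambda>z. \<Sum>k. c k * z ^ (k + 1))"
proof -
  define f where "f = (\<lambda>z. \<Sum>k. c k * z ^ (k + 1))"
  define Q where "Q = (\<lambda>z. \<Sum>k. c k * z ^ k)"
  define Q' where "Q' = (\<lambda>z. \<Sum>k. diffs c k * z ^ k)"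
  have "summable c"
    using summable_norm_cancel[OF sm] by (simp add: summable_Suc_iff)
  \<comment> \<open>Convergence at the point 1 makes the series analytic in the whole unit
    disc.\<close>
  then have c1: "summable (\<lambda>k. c k * 1 ^ k)" by simp
  have f_eq: "f z = z * Q z" if "norm z < 1" for z
    using powser_inside[OF c1, of z] that
    by (simp add: f_def Q_def suminf_mult[symmetric] mult_ac)
  have Q: "(Q has_field_derivative Q' z) (at z)" if "norm z < 1" for z
    using termdiffs_strong[OF c1, of z] that by (simp add: Q_def Q'_def)
  have f: "(f has_field_derivative Q z + z * Q' z) (at z)" if "norm z < 1" for z
  proof (rule has_field_derivative_transform_within_open)
    show "((\<lambda>z. z * Q z) has_field_derivative Q z + z * Q' z) (at z)"
      using Q[OF that] by (auto intro!: derivative_eq_intros)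
  qed (use that f_eq in \<open>auto intro: open_ball[of 0 1]\<close>)
  have est: "norm (z * Q' z) + norm (Q z - 1) \<le> 2 * norm z" if "norm z < 1 / 2" for z
    using powser_estimate_half_disc[OF c0 sm le that] by (simp add: Q_def Q'_def)
  have hol: "f holomorphic_on ball 0 1"
    unfolding holomorphic_on_open[OF open_ball] using f by (metis mem_ball_0)
  have f0: "f 0 = 0" by (simp add: f_def)
  have "deriv f 0 = 1"
    using DERIV_imp_deriv[OF f[of 0]] c0 by (simp add: Q_def)
  have inj: "inj_on f (ball 0 (1 / 2))"
  proof (rule inj_on_ball_if_deriv_near_1)
    fix z :: complex assume z: "norm z < 1 / 2"
    then show "(f has_field_derivative Q z + z * Q' z) (at z)" by (intro f) simp
    show "norm (Q z + z * Q' z - 1) \<le> 2 * norm z"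
      using est[OF z] norm_triangle_ineq[of "z * Q' z" "Q z - 1"] by (simp add: algebra_simps)
  qed auto
  have pos: "0 < Re (z * deriv f z / f z)" if z: "z \<in> ball 0 (1 / 2)" "z \<noteq> 0" for z
  proof -
    \<comment> \<open>By \<open>est\<close> the two norms sum to less than 1, while
      \<open>|Q z| \<ge> 1 - |Q z - 1|\<close>.\<close>
    have "norm (z * Q' z) < norm (Q z)"
      using est[of z] z norm_triangle_ineq2[of 1 "1 - Q z"] by (simp add: norm_minus_commute)
    then have lt: "norm (z * Q' z / Q z) < 1" and "Q z \<noteq> 0"
      by (auto simp: norm_divide divide_less_eq)
    have "z * deriv f z / f z = 1 + z * Q' z / Q z"
      using DERIV_imp_deriv[OF f[of z]] f_eq[of z] z \<open>Q z \<noteq> 0\<close> by (simp add: field_simps)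
    then show ?thesis
      using lt abs_Re_le_cmod[of "z * Q' z / Q z"] by (simp only: plus_complex.sel one_complex.sel)
  qed
  have "starlike_wrt 0 (f ` ball 0 (1 / 2))"
    by (rule starlike_wrt_image_ball[OF holomorphic_on_subset[OF hol] inj f0 _ pos]) auto
  then show ?thesis
    using hol f0 \<open>deriv f 0 = 1\<close> inj by (simp add: starlike_in_disc_def f_def)
qed

section \<open>Concavity of Digamma and monotone Gamma ratios\<close>

text \<open>This is concavity: \<open>Polygamma 1\<close> is the derivative of
  \<open>Digamma\<close> and decreases on the positive reals, so the mean value theorem compares the
  slopes on either side of \<open>y\<close>.\<close>

lemma Digamma_above_tangent:
  fixes x y :: real
  assumes "0 < x" "0 < y"
  shows "Polygamma 1 y * (y - x) \<le> Digamma y - Digamma x"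
proof -
  have mvt: "\<exists>\<xi>. u < \<xi> \<and> \<xi> < v \<and> Digamma v - Digamma u = (v - u) * Polygamma 1 \<xi>"
    if "0 < u" "u < v" for u v :: real
    using that MVT2[of u v Digamma "Polygamma 1"]
    by (force intro!: derivative_eq_intros elim!: nonpos_Ints_cases)
  consider "x = y" | "x < y" | "y < x" by linarith
  then show ?thesis
  proof cases
    case 2
    then obtain \<xi> where "x < \<xi>" "\<xi> < y" "Digamma y - Digamma x = (y - x) * Polygamma 1 \<xi>"
      using mvt assms by blast
    moreover from this have "Polygamma 1 y < Polygamma 1 \<xi>"
      using assms by (intro Polygamma_real_strict_antimono) auto
    ultimately show ?thesis using 2 by (simp add: mult.commute mult_left_mono)
  next
    case 3
    then obtain \<xi> where "y < \<xi>" "\<xi> < x" "Digamma x - Digamma y = (x - y) * Polygamma 1 \<xi>"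
      using mvt assms by blast
    moreover from this have "Polygamma 1 \<xi> < Polygamma 1 y"
      using assms by (intro Polygamma_real_strict_antimono) auto
    ultimately have "Digamma x - Digamma y \<le> (x - y) * Polygamma 1 y"
      using 3 by (simp add: mult_left_mono)
    then show ?thesis by (simp add: algebra_simps)
  qed simp
qed

lemma sum_decreasing_weights_nonneg:
  fixes s d :: "nat \<Rightarrow> real"
  assumes "\<And>k. k \<in> {1..p} \<Longrightarrow> 0 \<le> (\<Sum>j=1..k. d j)"
    and "\<And>i. i \<in> {1..p} \<Longrightarrow> 0 \<le> s i"
    and "\<And>i j. i \<in> {1..p} \<Longrightarrow> j \<in> {1..p} \<Longrightarrow> i \<le> j \<Longrightarrow> s j \<le> s i"
  shows "0 \<le> (\<Sum>i=1..p. s i * d i)"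
proof (cases "p = 0")
  case False
  \<comment> \<open>Abel summation, as an invariant of the partial sums\<close>
  have "s k * (\<Sum>j=1..k. d j) \<le> (\<Sum>i=1..k. s i * d i)" if "1 \<le> k" "k \<le> p" for k
    using that
  proof (induction k rule: nat_induct_at_least)
    case base
    then show ?case by simp
  next
    case (Suc k)
    \<comment> \<open>Lowering the weight can only lower the left side, because the partial sum is
      nonnegative.\<close>
    have "s (Suc k) * (\<Sum>j=1..k. d j) \<le> s k * (\<Sum>j=1..k. d j)"
      using Suc assms(1)[of k] assms(3)[of k "Suc k"] by (intro mult_right_mono) auto
    with Suc show ?case by (simp add: algebra_simps)
  qed
  from this[of p] False show ?thesis
    using mult_nonneg_nonneg[OF assms(2)[of p] assms(1)[of p]] by force
qed simp

text \<open>An instance of the Tomic-Weyl inequality for increasing concave functions. Tangents are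
  taken at the \<open>b i\<close>, so the weights \<open>Polygamma 1 (b i)\<close> are positive and,
  \<open>b\<close> being increasing, decreasing in \<open>i\<close>; Abel summation then
  applies.\<close>

lemma sum_Digamma_mono_weak_majorization:
  fixes a b :: "nat \<Rightarrow> real"
  assumes a: "\<And>i. i \<in> {1..p} \<Longrightarrow> 0 < a i" and b: "\<And>i. i \<in> {1..p} \<Longrightarrow> 0 < b i"
    and mono: "mono_on {1..p} b"
    and major: "\<And>k. k \<in> {1..p} \<Longrightarrow> 0 \<le> (\<Sum>j=1..k. b j) - (\<Sum>j=1..k. a j)"
  shows "(\<Sum>i=1..p. Digamma (a i)) \<le> (\<Sum>i=1..p. Digamma (b i))"
proof -
  have "0 \<le> (\<Sum>i=1..p. Polygamma 1 (b i) * (b i - a i))"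
  proof (rule sum_decreasing_weights_nonneg)
    fix i assume "i \<in> {1..p}"
    with b show "0 \<le> Polygamma 1 (b i)"
      by (intro less_imp_le Polygamma_real_odd_pos) (force elim!: nonpos_Ints_cases)+
  next
    fix i j assume ij: "i \<in> {1..p}" "j \<in> {1..p}" "i \<le> j"
    then have "b i \<le> b j" using mono by (auto simp: mono_on_def)
    then show "Polygamma 1 (b j) \<le> Polygamma 1 (b i)"
      using Polygamma_real_strict_antimono[of "b i" "b j" 1] b[of i] ij
      by (cases "b i = b j") auto
  qed (use major in \<open>auto simp: sum_subtractf\<close>)
  also have "\<dots> \<le> (\<Sum>i=1..p. Digamma (b i) - Digamma (a i))"
    by (intro sum_mono Digamma_above_tangent a b)
  finally show ?thesis by (simp add: sum_subtractf)
qed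

text \<open>The logarithmic derivative at \<open>t\<close> is a difference of Digamma sums. Shifting
  all parameters by \<open>t\<close> adds the same amount \<open>k t\<close> to both partial sums,
  so the previous inequality gives its sign.\<close>

lemma prod_Gamma_ratio_antimono:
  fixes a b :: "nat \<Rightarrow> real"
  assumes a: "\<And>i. i \<in> {1..p} \<Longrightarrow> 0 < a i" and b: "\<And>i. i \<in> {1..p} \<Longrightarrow> 0 < b i"
    and mono: "mono_on {1..p} b"
    and major: "\<And>k. k \<in> {1..p} \<Longrightarrow> 0 \<le> (\<Sum>j=1..k. b j) - (\<Sum>j=1..k. a j)"
    and xy: "0 \<le> x" "x \<le> y"
  shows "(\<Prod>i=1..p. Gamma (a i + y) / Gamma (b i + y)) \<le> (\<Prod>i=1..p. Gamma (a i + x) / Gamma (b i + x))"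
proof -
  define L where "L = (\<lambda>t. \<Sum>i=1..p. ln_Gamma (a i + t) - ln_Gamma (b i + t))"
  have "L y \<le> L x"
  proof (rule DERIV_nonpos_imp_nonincreasing[OF xy(2)])
    fix t assume "x \<le> t"
    then have t: "0 \<le> t" using xy by simp
    have "(L has_real_derivative (\<Sum>i=1..p. Digamma (a i + t) - Digamma (b i + t))) (at t)"
      unfolding L_def using a b t by (auto intro!: derivative_eq_intros sum.cong simp: add_pos_nonneg)
    moreover have "(\<Sum>i=1..p. Digamma (a i + t)) \<le> (\<Sum>i=1..p. Digamma (b i + t))"
      using a b t mono major
      by (intro sum_Digamma_mono_weak_majorization)
        (auto simp: add_pos_nonneg mono_on_def sum.distrib)
    ultimately show "\<exists>D. (L has_real_derivative D) (at t) \<and> D \<le> 0"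
      by (auto simp: sum_subtractf)
  qed
  moreover have "(\<Prod>i=1..p. Gamma (a i + t) / Gamma (b i + t)) = exp (L t)" if "0 \<le> t" for t
    unfolding L_def exp_sum[OF finite_atLeastAtMost]
    by (intro prod.cong refl) (use a b that in \<open>auto simp: exp_diff Gamma_real_pos_exp add_pos_nonneg\<close>)
  ultimately show ?thesis using xy by simp
qed

section \<open>Bounds for the coefficient sum\<close>

text \<open>Expanding the right side gives both pure products and nonnegative mixed terms. An empty
  \<open>I\<close> would give \<open>2 \<le> 1\<close>.\<close>

lemma prod_add_prod_le:
  fixes x y :: "'i \<Rightarrow> 'a::linordered_semidom"
  assumes "finite I" "I \<noteq> {}" "\<And>i. i \<in> I \<Longrightarrow> 0 \<le> x i" "\<And>i. i \<in> I \<Longrightarrow> 0 \<le> y i"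
  shows "prod x I + prod y I \<le> (\<Prod>i\<in>I. x i + y i)"
  using assms
proof (induction I rule: finite_ne_induct)
  case (insert i I)
  have "x i * prod x I + y i * prod y I \<le> x i * prod x I + y i * prod y I + (x i * prod y I + y i * prod x I)"
    using insert by (simp add: prod_nonneg)
  also have "\<dots> = (x i + y i) * (prod x I + prod y I)"
    by (simp add: algebra_simps)
  also have "\<dots> \<le> (x i + y i) * (\<Prod>i\<in>I. x i + y i)"
    using insert by (intro mult_left_mono) auto
  finally show ?case using insert by simp
qed simp

text \<open>The reciprocal factorials from index 2 on sum to \<open>e - 2\<close>, and
  \<open>R 2\<close> bounds every numerator there; the term of index 1 is kept exactly.\<close>

lemma sum_decreasing_over_fact_le:
  fixes R :: "nat \<Rightarrow> real"
  assumes "\<And>k. 0 \<le> R k" and dec: "\<And>k. 2 \<le> k \<Longrightarrow> R k \<le> R 2"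
  shows "summable (\<lambda>k. R (Suc k) / fact (Suc k))"
    and "(\<Sum>k. R (Suc k) / fact (Suc k)) \<le> R 1 + (exp 1 - 2) * R 2"
proof -
  have "(\<lambda>n. 1 / fact n) sums exp (1::real)"
    using exp_converges[of "1::real"] by (simp add: inverse_eq_divide)
  then have "(\<lambda>n. 1 / fact (n + 2)) sums (exp 1 - (\<Sum>i<2. 1 / fact i) :: real)"
    by (rule sums_split_initial_segment)
  then have "(\<lambda>k. 1 / fact (Suc (Suc k))) sums (exp 1 - 2 :: real)"
    by (simp add: eval_nat_numeral)
  from sums_mult2[OF this, of "R 2"]
  have tail: "(\<lambda>k. R 2 / fact (Suc (Suc k))) sums ((exp 1 - 2) * R 2)"
    by simp
  have le: "R (Suc (Suc k)) / fact (Suc (Suc k)) \<le> R 2 / fact (Suc (Suc k))" for k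
    using dec[of "Suc (Suc k)"] by (intro divide_right_mono) auto
  have sm: "summable (\<lambda>k. R (Suc (Suc k)) / fact (Suc (Suc k)))"
    by (rule summable_comparison_test'[OF sums_summable[OF tail], of 0])
      (use assms(1) le in \<open>simp del: fact_Suc\<close>)
  then show sm1: "summable (\<lambda>k. R (Suc k) / fact (Suc k))"
    by (subst (asm) summable_Suc_iff)
  have "(\<Sum>k. R (Suc (Suc k)) / fact (Suc (Suc k))) \<le> (exp 1 - 2) * R 2"
    using suminf_le[OF le sm sums_summable[OF tail]] sums_unique[OF tail] by simp
  then show "(\<Sum>k. R (Suc k) / fact (Suc k)) \<le> R 1 + (exp 1 - 2) * R 2"
    using suminf_split_head[OF sm1] by simp
qed

section \<open>The Fox-Wright function\<close>

lemma normalized_fox_wright_of_real: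
  fixes a b :: "nat \<Rightarrow> real"
  shows "normalized_fox_wright p p (\<lambda>i. of_real (a i)) (\<lambda>_. A) (\<lambda>i. of_real (b i)) (\<lambda>_. A) z =
    (\<Prod>i=1..p. of_real (Gamma (b i))) / (\<Prod>i=1..p. of_real (Gamma (a i))) *
    (\<Sum>k. of_real ((\<Prod>i=1..p. Gamma (a i + real k * A) / Gamma (b i + real k * A)) / fact k) * z ^ (k + 1))"
proof -
  have "Gamma (of_real x + of_nat k * of_real A) = complex_of_real (Gamma (x + real k * A))" for x k
    unfolding Gamma_complex_of_real[symmetric] by simp
  then show ?thesis
    unfolding normalized_fox_wright_def
    by (simp add: Gamma_complex_of_real prod_dividef)
qed

theorem theorem7:
  fixes p :: nat and A :: real and a b :: "nat \<Rightarrow> real"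
  assumes "p \<ge> 1" and "A > 0"
    and "0 < a 1" and "mono_on {1..p} a"
    and "0 < b 1" and "mono_on {1..p} b"
    and "\<And>k. k \<in> {1..p} \<Longrightarrow> (\<Sum>j=1..k. b j) - (\<Sum>j=1..k. a j) \<ge> 0"
    and "(\<Prod>i=1..p. Gamma (a i + A) / Gamma (b i + A)
             - Gamma (a i + 2 * A) / Gamma (b i + 2 * A) * (1 - exp 1))
         \<le> (\<Prod>i=1..p. Gamma (a i) / Gamma (b i))"
  shows "starlike_in_disc (1 / 2)
           (normalized_fox_wright p p (\<lambda>i. complex_of_real (a i)) (\<lambda>_. A)
              (\<lambda>i. complex_of_real (b i)) (\<lambda>_. A))"
proof -
  define R where "R = (\<lambda>k. \<Prod>i=1..p. Gamma (a i + real k * A) / Gamma (b i + real k * A))"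
  have a: "0 < a i" and b: "0 < b i" if "i \<in> {1..p}" for i
    using that assms(1,3-6) mono_onD[of "{1..p}" a 1 i] mono_onD[of "{1..p}" b 1 i] by auto
  have ak: "0 < a i + real k * A" and bk: "0 < b i + real k * A" if "i \<in> {1..p}" for i k
    using a[OF that] b[OF that] \<open>A > 0\<close> by (auto intro: add_pos_nonneg)
  have R_pos: "0 < R k" for k
    unfolding R_def using ak bk by (intro prod_pos divide_pos_pos Gamma_real_pos) auto
  have R_dec: "R k \<le> R j" if "j \<le> k" for j k
    unfolding R_def using that \<open>A > 0\<close> assms(6,7)
    by (intro prod_Gamma_ratio_antimono a b) auto
  have e: "2 \<le> exp (1::real)"
    using exp_ge_add_one_self[of 1] by simp
  \<comment> \<open>The weaker constant \<open>(e - 1)^p\<close> distributes one factor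
    \<open>e - 1\<close> to each index of \<open>R 2\<close>, which reaches the product form of the
    hypothesis.\<close>
  have "R 1 + (exp 1 - 2) * R 2 \<le> R 1 + (exp 1 - 1) ^ p * R 2"
  proof -
    have "exp 1 - 2 \<le> (exp 1 - 1 :: real) ^ 1" by simp
    also have "\<dots> \<le> (exp 1 - 1) ^ p"
      using e \<open>p \<ge> 1\<close> by (intro power_increasing) auto
    finally show ?thesis using R_pos[of 2] by (simp add: mult_right_mono)
  qed
  also have "\<dots> = (\<Prod>i=1..p. Gamma (a i + A) / Gamma (b i + A))
      + (\<Prod>i=1..p. (exp 1 - 1) * (Gamma (a i + 2 * A) / Gamma (b i + 2 * A)))"
    by (simp add: R_def prod.distrib del: times_divide_eq_right)
  also have "\<dots> \<le> (\<Prod>i=1..p. Gamma (a i + A) / Gamma (b i + A)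
      + (exp 1 - 1) * (Gamma (a i + 2 * A) / Gamma (b i + 2 * A)))"
    using \<open>p \<ge> 1\<close> e ak[of _ 1] bk[of _ 1] ak[of _ 2] bk[of _ 2]
    by (intro prod_add_prod_le mult_nonneg_nonneg divide_nonneg_nonneg less_imp_le[OF Gamma_real_pos]) auto
  also have "\<dots> \<le> R 0"
  proof -
    have "u + (exp 1 - 1) * v = u - v * (1 - exp 1)" for u v :: real
      by (simp add: algebra_simps)
    then show ?thesis using assms(8) by (simp add: R_def)
  qed
  finally have main: "R 1 + (exp 1 - 2) * R 2 \<le> R 0" .
  \<comment> \<open>Division by \<open>R 0\<close> makes \<open>c 0 = 1\<close>; its reciprocal is
    the Gamma prefactor of the normalized function.\<close>
  define c where "c = (\<lambda>k. complex_of_real (R k / fact k / R 0))"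
  have norm_c: "norm (c k) = R k / fact k / R 0" for k
    unfolding c_def norm_of_real using R_pos[of k] R_pos[of 0] by simp
  note series = sum_decreasing_over_fact_le[of R, OF less_imp_le[OF R_pos] R_dec]
  have "starlike_in_disc (1 / 2) (\<lambda>z. \<Sum>k. c k * z ^ (k + 1))"
  proof (rule starlike_in_half_disc_powser)
    show "c 0 = 1" using R_pos[of 0] by (simp add: c_def)
    show "summable (\<lambda>k. norm (c (Suc k)))"
      unfolding norm_c by (intro summable_divide series)
    have "(\<Sum>k. norm (c (Suc k))) = (\<Sum>k. R (Suc k) / fact (Suc k)) / R 0"
      unfolding norm_c by (intro suminf_divide series)
    then show "(\<Sum>k. norm (c (Suc k))) \<le> 1"
      using series(2) main R_pos[of 0] by (simp add: divide_le_eq_1)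
  qed
  moreover have "(\<Sum>k. c k * z ^ (k + 1)) = normalized_fox_wright p p (\<lambda>i. complex_of_real (a i)) (\<lambda>_. A)
              (\<lambda>i. complex_of_real (b i)) (\<lambda>_. A) z" for z
  proof -
    \<comment> \<open>Pulling the constant out of the sum needs convergence, and for every
      \<open>z\<close>, since the functions must agree on the whole plane. As
      \<open>R k \<le> R 0\<close>, an exponential series dominates.\<close>
    have "summable (\<lambda>k. of_real (R k / fact k) * z ^ (k + 1))"
    proof (rule summable_comparison_test'[of "\<lambda>k. R 0 * norm z * (inverse (fact k) * norm z ^ k)" 0])
      show "summable (\<lambda>k. R 0 * norm z * (inverse (fact k) * norm z ^ k))"
        by (intro summable_mult summable_exp)
      show "norm (of_real (R k / fact k) * z ^ (k + 1)) \<le> R 0 * norm z * (inverse (fact k) * norm z ^ k)" for k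
        using R_dec[of 0 k] R_pos[of k]
        by (simp add: norm_mult norm_power norm_inverse divide_inverse mult_ac mult_right_mono)
    qed
    then have "(\<Sum>k. c k * z ^ (k + 1)) = inverse (of_real (R 0)) * (\<Sum>k. of_real (R k / fact k) * z ^ (k + 1))"
      by (subst suminf_mult[symmetric]) (simp_all add: c_def divide_inverse mult_ac)
    moreover have "inverse (of_real (R 0)) =
        (\<Prod>i=1..p. complex_of_real (Gamma (b i))) / (\<Prod>i=1..p. complex_of_real (Gamma (a i)))"
      by (simp add: R_def prod_dividef)
    ultimately show ?thesis
      by (simp only: normalized_fox_wright_of_real R_def)
  qed
  ultimately show ?thesis by (simp only:)
qed

end
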